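(* Let $H\le G$ be a closed embedding of topological groups such that the translation action of $H$ on $G$ is principal. Let $H$ act freely and continuously on a space $Y$. If the induced action of $G$ on $X:=G\times_H Y$ is principal, then the action of $H$ on $Y$ is principal. In particular, if in addition $G$ is compact, then: - if every free continuous $G$-action on a Tychonoff space is principal, then every free continuous $H$-action on a Tychonoff space is principal; - if every free continuous $G$-action on a compact Hausdorff space is principal, then every free continuous $H$-action on a compact Hausdorff space is principal.
   Context: Topological groups and the spaces acted upon are assumed Tychonoff (completely regular Hausdorff). A free continuous action of a topological group $K$ on a space $Z$ is principal if $Z\to Z/K$ is a locally trivial principal $K$-bundle; equivalently, every $K$-orbit in $Z$ has an open $K$-invariant neighborhood admitting a continuous $K$-equivariant map to $K$ (with its left translation action). The twisted product $G\times_H Y$ is the quotient of $G\times Y$ by the equivalence relation $(gh,y)\sim(g,hy)$ for $g\in G$, $h\in H$, $y\in Y$, with $G$ acting by left multiplication on the first factor. *)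

theory Defs
  imports "HOL-Analysis.Analysis" "HOL-Algebra.Group_Action"
begin

definition tychonoff_space :: "'a topology \<Rightarrow> bool" where
  "tychonoff_space X \<longleftrightarrow> completely_regular_space X \<and> Hausdorff_space X"

definition topological_group :: "('g, 'm) monoid_scheme \<Rightarrow> 'g topology \<Rightarrow> bool" where
  "topological_group G T \<longleftrightarrow>
     group G \<and> topspace T = carrier G \<and>
     continuous_map (prod_topology T T) T (\<lambda>(x, y). x \<otimes>\<^bsub>G\<^esub> y) \<and>
     continuous_map T T (\<lambda>x. inv\<^bsub>G\<^esub> x)"

definition quotient_topology :: "'a topology \<Rightarrow> ('a \<Rightarrow> 'b) \<Rightarrow> 'b topology" where
  "quotient_topology X q =
     topology (\<lambda>U. U \<subseteq> q ` topspace X \<and> openin X {x \<in> topspace X. q x \<in> U})"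

lemma openin_quotient_topology:
  "openin (quotient_topology X q) U \<longleftrightarrow>
     U \<subseteq> q ` topspace X \<and> openin X {x \<in> topspace X. q x \<in> U}"
proof -
  have "istopology (\<lambda>U. U \<subseteq> q ` topspace X \<and> openin X {x \<in> topspace X. q x \<in> U})"
    unfolding istopology_def
  proof (intro conjI allI impI)
    fix S T
    assume S: "S \<subseteq> q ` topspace X \<and> openin X {x \<in> topspace X. q x \<in> S}"
      and T: "T \<subseteq> q ` topspace X \<and> openin X {x \<in> topspace X. q x \<in> T}"
    have "{x \<in> topspace X. q x \<in> S \<inter> T}
        = {x \<in> topspace X. q x \<in> S} \<inter> {x \<in> topspace X. q x \<in> T}" by auto
    then show "openin X {x \<in> topspace X. q x \<in> S \<inter> T}"
      using S T by auto
    show "S \<inter> T \<subseteq> q ` topspace X" using S by auto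
  next
    fix \<K>
    assume K: "\<forall>K\<in>\<K>. K \<subseteq> q ` topspace X \<and> openin X {x \<in> topspace X. q x \<in> K}"
    have "{x \<in> topspace X. q x \<in> \<Union>\<K>} = \<Union>((\<lambda>K. {x \<in> topspace X. q x \<in> K}) ` \<K>)" by auto
    then show "openin X {x \<in> topspace X. q x \<in> \<Union>\<K>}"
      using K by auto
    show "\<Union>\<K> \<subseteq> q ` topspace X" using K by auto
  qed
  then show ?thesis
    by (simp add: quotient_topology_def)
qed

lemma topspace_quotient_topology [simp]:
  "topspace (quotient_topology X q) = q ` topspace X"
proof
  show "topspace (quotient_topology X q) \<subseteq> q ` topspace X"
    using openin_quotient_topology[of X q "topspace (quotient_topology X q)"] by simp
  have "{x \<in> topspace X. q x \<in> q ` topspace X} = topspace X" by auto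
  then have "openin (quotient_topology X q) (q ` topspace X)"
    by (simp add: openin_quotient_topology)
  then show "q ` topspace X \<subseteq> topspace (quotient_topology X q)"
    by (rule openin_subset)
qed

lemma quotient_map_quotient_topology: "quotient_map X (quotient_topology X q) q"
  by (auto simp: quotient_map_def openin_quotient_topology)

definition free_continuous_action ::
  "('k, 'm) monoid_scheme \<Rightarrow> 'k topology \<Rightarrow> 'z topology \<Rightarrow> ('k \<Rightarrow> 'z \<Rightarrow> 'z) \<Rightarrow> bool" where
  "free_continuous_action K TK Z \<phi> \<longleftrightarrow>
     group_action K (topspace Z) \<phi> \<and>
     continuous_map (prod_topology TK Z) Z (\<lambda>(k, z). \<phi> k z) \<and>
     (\<forall>z \<in> topspace Z. stabilizer K \<phi> z = {\<one>\<^bsub>K\<^esub>})"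

definition orbit_space ::
  "('k, 'm) monoid_scheme \<Rightarrow> 'z topology \<Rightarrow> ('k \<Rightarrow> 'z \<Rightarrow> 'z) \<Rightarrow> 'z set topology" where
  "orbit_space K Z \<phi> = quotient_topology Z (orbit K \<phi>)"

text \<open>Local triviality of \<open>Z \<rightarrow> Z/K\<close>: each point of \<open>Z/K\<close> has an open neighbourhood \<open>U\<close>
  over which \<open>Z\<close> is homeomorphic to \<open>U \<times> K\<close>, by a homeomorphism that lies over \<open>U\<close> and is
  equivariant for left translation on the factor \<open>K\<close>.\<close>

definition locally_trivial_principal_bundle ::
  "('k, 'm) monoid_scheme \<Rightarrow> 'k topology \<Rightarrow> 'z topology \<Rightarrow> ('k \<Rightarrow> 'z \<Rightarrow> 'z) \<Rightarrow> bool" where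
  "locally_trivial_principal_bundle K TK Z \<phi> \<longleftrightarrow>
     (\<forall>b \<in> topspace (orbit_space K Z \<phi>). \<exists>U f.
        openin (orbit_space K Z \<phi>) U \<and> b \<in> U \<and>
        homeomorphic_map
          (subtopology Z {z \<in> topspace Z. orbit K \<phi> z \<in> U})
          (prod_topology (subtopology (orbit_space K Z \<phi>) U) TK) f \<and>
        (\<forall>z \<in> topspace Z. orbit K \<phi> z \<in> U \<longrightarrow>
           fst (f z) = orbit K \<phi> z \<and>
           (\<forall>k \<in> carrier K. snd (f (\<phi> k z)) = k \<otimes>\<^bsub>K\<^esub> snd (f z))))"

definition principal_action ::
  "('k, 'm) monoid_scheme \<Rightarrow> 'k topology \<Rightarrow> 'z topology \<Rightarrow> ('k \<Rightarrow> 'z \<Rightarrow> 'z) \<Rightarrow> bool" where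
  "principal_action K TK Z \<phi> \<longleftrightarrow>
     free_continuous_action K TK Z \<phi> \<and> locally_trivial_principal_bundle K TK Z \<phi>"

text \<open>Actions in the sense of \<^locale>\<open>group_action\<close> are extensional on the space acted upon,
  hence the restricted abstractions below.\<close>

definition translation_action :: "('g, 'm) monoid_scheme \<Rightarrow> 'g \<Rightarrow> 'g \<Rightarrow> 'g" where
  "translation_action G = (\<lambda>h. \<lambda>x \<in> carrier G. h \<otimes>\<^bsub>G\<^esub> x)"

text \<open>Since \<open>H\<close> is a subgroup, the pairs \<open>(gh, y) \<sim> (g, hy)\<close> already form an equivalence
  relation, so no closure is taken.\<close>

definition twisted_rel ::
  "('g, 'm) monoid_scheme \<Rightarrow> 'g set \<Rightarrow> 'y set \<Rightarrow> ('g \<Rightarrow> 'y \<Rightarrow> 'y) \<Rightarrow> ('g \<times> 'y) rel" where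
  "twisted_rel G H Y \<phi> =
     {((g \<otimes>\<^bsub>G\<^esub> h, y), (g, \<phi> h y)) | g h y. g \<in> carrier G \<and> h \<in> H \<and> y \<in> Y}"

lemma equiv_twisted_rel:
  assumes "group G" "subgroup H G" "group_action (G\<lparr>carrier := H\<rparr>) Y \<phi>"
  shows "equiv (carrier G \<times> Y) (twisted_rel G H Y \<phi>)"
proof -
  interpret G: group G by fact
  interpret H: subgroup H G by fact
  interpret A: group_action "G\<lparr>carrier := H\<rparr>" Y \<phi> by fact
  have closed: "\<phi> h y \<in> Y" if "h \<in> H" "y \<in> Y" for h y
    using A.element_image[of h y] that by simp
  have comp: "\<phi> h (\<phi> k y) = \<phi> (h \<otimes>\<^bsub>G\<^esub> k) y" if "h \<in> H" "k \<in> H" "y \<in> Y" for h k y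
    using A.composition_rule[of y h k] that by simp
  have one: "\<phi> \<one>\<^bsub>G\<^esub> y = y" if "y \<in> Y" for y
    using fun_cong[OF A.id_eq_one, of y] that by simp
  have mem: "((a, y), (b, z)) \<in> twisted_rel G H Y \<phi> \<longleftrightarrow>
      (\<exists>h\<in>H. b \<in> carrier G \<and> y \<in> Y \<and> a = b \<otimes>\<^bsub>G\<^esub> h \<and> z = \<phi> h y)" for a y b z
    unfolding twisted_rel_def by blast
  show ?thesis
  proof (rule equivI)
    show "twisted_rel G H Y \<phi> \<subseteq> (carrier G \<times> Y) \<times> (carrier G \<times> Y)"
      unfolding twisted_rel_def using closed H.subset by auto
    show "refl_on (carrier G \<times> Y) (twisted_rel G H Y \<phi>)"
      by (rule refl_onI) (auto simp: mem one intro!: bexI[of _ "\<one>\<^bsub>G\<^esub>"])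
    show "sym (twisted_rel G H Y \<phi>)"
    proof (rule symI, clarify)
      fix a y b z assume "((a, y), (b, z)) \<in> twisted_rel G H Y \<phi>"
      then obtain h where h: "h \<in> H" "b \<in> carrier G" "y \<in> Y" "a = b \<otimes>\<^bsub>G\<^esub> h" "z = \<phi> h y"
        by (auto simp: mem)
      have "b = a \<otimes>\<^bsub>G\<^esub> inv\<^bsub>G\<^esub> h" "y = \<phi> (inv\<^bsub>G\<^esub> h) z" "z \<in> Y" "a \<in> carrier G"
        using h by (auto simp: G.m_assoc comp one closed)
      then show "((b, z), (a, y)) \<in> twisted_rel G H Y \<phi>"
        using h(1) by (auto simp: mem)
    qed
    show "trans (twisted_rel G H Y \<phi>)"
    proof (rule transI, clarify)
      fix a y b z c w
      assume "((a, y), (b, z)) \<in> twisted_rel G H Y \<phi>" "((b, z), (c, w)) \<in> twisted_rel G H Y \<phi>"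
      then obtain h k where h: "h \<in> H" "y \<in> Y" "a = b \<otimes>\<^bsub>G\<^esub> h" "z = \<phi> h y"
        and k: "k \<in> H" "c \<in> carrier G" "b = c \<otimes>\<^bsub>G\<^esub> k" "w = \<phi> k z"
        by (auto simp: mem)
      have "a = c \<otimes>\<^bsub>G\<^esub> (k \<otimes>\<^bsub>G\<^esub> h)" "w = \<phi> (k \<otimes>\<^bsub>G\<^esub> h) y"
        using h k by (auto simp: G.m_assoc comp)
      then show "((a, y), (c, w)) \<in> twisted_rel G H Y \<phi>"
        using h k by (auto simp: mem)
    qed
  qed
qed

definition twisted_product ::
  "('g, 'm) monoid_scheme \<Rightarrow> 'g topology \<Rightarrow> 'g set \<Rightarrow> 'y topology \<Rightarrow> ('g \<Rightarrow> 'y \<Rightarrow> 'y)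
     \<Rightarrow> ('g \<times> 'y) set topology" where
  "twisted_product G TG H Y \<phi> =
     quotient_topology (prod_topology TG Y) (\<lambda>p. twisted_rel G H (topspace Y) \<phi> `` {p})"

text \<open>The class of \<open>(a, y)\<close> is sent to the class of \<open>(ga, y)\<close>, which is its image under
  \<open>(a, y) \<mapsto> (ga, y)\<close>.\<close>

definition twisted_action ::
  "('g, 'm) monoid_scheme \<Rightarrow> 'g topology \<Rightarrow> 'g set \<Rightarrow> 'y topology \<Rightarrow> ('g \<Rightarrow> 'y \<Rightarrow> 'y)
     \<Rightarrow> 'g \<Rightarrow> ('g \<times> 'y) set \<Rightarrow> ('g \<times> 'y) set" where
  "twisted_action G TG H Y \<phi> =
     (\<lambda>g. \<lambda>c \<in> topspace (twisted_product G TG H Y \<phi>). (\<lambda>(a, y). (g \<otimes>\<^bsub>G\<^esub> a, y)) ` c)"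

lemma twisted_action_class:
  assumes "group G" "subgroup H G" "group_action (G\<lparr>carrier := H\<rparr>) (topspace Y) \<phi>"
    and "topspace TG = carrier G" "g \<in> carrier G" "a \<in> carrier G" "y \<in> topspace Y"
  shows "twisted_action G TG H Y \<phi> g (twisted_rel G H (topspace Y) \<phi> `` {(a, y)}) =
           twisted_rel G H (topspace Y) \<phi> `` {(g \<otimes>\<^bsub>G\<^esub> a, y)}"
proof -
  interpret G: group G by fact
  interpret H: subgroup H G by fact
  have cls: "twisted_rel G H (topspace Y) \<phi> `` {(b, y)} =
      (\<lambda>h. (b \<otimes>\<^bsub>G\<^esub> inv\<^bsub>G\<^esub> h, \<phi> h y)) ` H" if "b \<in> carrier G" for b
  proof (intro equalityI subsetI)
    fix p assume "p \<in> twisted_rel G H (topspace Y) \<phi> `` {(b, y)}"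
    then obtain c h where ch: "c \<in> carrier G" "h \<in> H" "b = c \<otimes>\<^bsub>G\<^esub> h" "p = (c, \<phi> h y)"
      unfolding twisted_rel_def by auto
    then have "c = b \<otimes>\<^bsub>G\<^esub> inv\<^bsub>G\<^esub> h" by (simp add: G.m_assoc)
    then have "p = (b \<otimes>\<^bsub>G\<^esub> inv\<^bsub>G\<^esub> h, \<phi> h y)" using ch(4) by blast
    then show "p \<in> (\<lambda>h. (b \<otimes>\<^bsub>G\<^esub> inv\<^bsub>G\<^esub> h, \<phi> h y)) ` H" using ch(2) by blast
  next
    fix p assume "p \<in> (\<lambda>h. (b \<otimes>\<^bsub>G\<^esub> inv\<^bsub>G\<^esub> h, \<phi> h y)) ` H"
    then obtain h where h: "h \<in> H" "p = (b \<otimes>\<^bsub>G\<^esub> inv\<^bsub>G\<^esub> h, \<phi> h y)" by auto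
    then have "b = (b \<otimes>\<^bsub>G\<^esub> inv\<^bsub>G\<^esub> h) \<otimes>\<^bsub>G\<^esub> h" "b \<otimes>\<^bsub>G\<^esub> inv\<^bsub>G\<^esub> h \<in> carrier G"
      using that by (auto simp: G.m_assoc)
    then show "p \<in> twisted_rel G H (topspace Y) \<phi> `` {(b, y)}"
      unfolding twisted_rel_def using h assms(7) by blast
  qed
  have "twisted_rel G H (topspace Y) \<phi> `` {(a, y)} \<in> topspace (twisted_product G TG H Y \<phi>)"
    using assms by (auto simp: twisted_product_def)
  then show ?thesis
    using assms by (auto simp: twisted_action_def cls image_image G.m_assoc)
qed

end

theory Submission
  imports Defs
begin

text \<open>Local triviality amounts to covering the space by open invariant sets with equivariant
  maps to the group. Composing \<open>Y \<rightarrow> G \<times>\<^sub>H Y\<close>, \<open>y \<mapsto> [1, y]\<close>, with such a map to \<open>G\<close> on the twisted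
  product, and then with such a map to \<open>H\<close> on \<open>G\<close>, covers \<open>Y\<close> in the same way.

  If \<open>G\<close> is compact, then so is \<open>H\<close>, and \<open>G \<times> Y \<rightarrow> G \<times>\<^sub>H Y\<close>, being the orbit map of an \<open>H\<close>-action, is
  both open and closed. Such maps preserve the Tychonoff property: the fibrewise infimum of
  a continuous function is again continuous. Hence the hypothesis on \<open>G\<close> applies to \<open>G \<times>\<^sub>H Y\<close>.\<close>

section \<open>Open and closed maps\<close>

text \<open>Every point of an open set has a box around it inside the set, and the image of a box is
  the box of the images. It is applied with the identity on a group as one factor: a product of
  quotient maps may fail to be a quotient map, whereas openness survives products.\<close>

lemma open_map_prod_top:
  assumes "open_map X X' f" "open_map Y Y' g"
  shows "open_map (prod_topology X Y) (prod_topology X' Y') (\<lambda>(x, y). (f x, g y))"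
  unfolding open_map_def
proof (intro allI impI)
  fix W assume W: "openin (prod_topology X Y) W"
  show "openin (prod_topology X' Y') ((\<lambda>(x, y). (f x, g y)) ` W)"
    unfolding openin_prod_topology_alt
  proof (intro allI impI)
    fix a b assume "(a, b) \<in> (\<lambda>(x, y). (f x, g y)) ` W"
    then obtain x y where xy: "(x, y) \<in> W" "a = f x" "b = g y" by auto
    then obtain U V where UV: "openin X U" "openin Y V" "x \<in> U" "y \<in> V" "U \<times> V \<subseteq> W"
      using W unfolding openin_prod_topology_alt by meson
    have "f ` U \<times> g ` V \<subseteq> (\<lambda>(x, y). (f x, g y)) ` W"
      using UV(5) by force
    moreover have "openin X' (f ` U)" "openin Y' (g ` V)"
      using UV assms by (auto simp: open_map_def)
    ultimately show "\<exists>U V. openin X' U \<and> openin Y' V \<and> a \<in> U \<and> b \<in> V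
        \<and> U \<times> V \<subseteq> (\<lambda>(x, y). (f x, g y)) ` W"
      using UV(3,4) xy(2,3) by blast
  qed
qed

text \<open>A function on \<open>X\<close> separating a point over \<open>y\<close> from the
  preimage of \<open>S\<close> need not be constant on the fibres of \<open>q\<close>, so it does
  not descend as it stands. Its infimum over each fibre does, and still separates: the fibre over
  \<open>y\<close> contains a zero of \<open>f\<close>, and \<open>f\<close> is constantly 1 on the
  fibres over \<open>S\<close>.\<close>

lemma completely_regular_space_open_closed_map_image:
  assumes cr: "completely_regular_space X"
    and cont: "continuous_map X Y q" and op: "open_map X Y q" and cl: "closed_map X Y q"
    and surj: "q ` topspace X = topspace Y"
  shows "completely_regular_space Y"
  unfolding completely_regular_space_alt
proof (intro allI impI)
  fix S y assume S: "closedin Y S" and y: "y \<in> topspace Y - S"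
  have qX: "\<exists>x. x \<in> topspace X \<and> q x = w" if "w \<in> topspace Y" for w
    using that unfolding surj[symmetric] by auto
  have qY: "q x \<in> topspace Y" if "x \<in> topspace X" for x
    using imageI[OF that, of q] unfolding surj .
  obtain x where x: "x \<in> topspace X" "q x = y" using qX y by blast
  define C where "C = {z \<in> topspace X. q z \<in> S}"
  have "closedin X C"
    unfolding C_def using cont S by (rule closedin_continuous_map_preimage)
  moreover have "x \<in> topspace X - C" using x y by (auto simp: C_def)
  ultimately obtain f :: "_ \<Rightarrow> real"
    where f: "continuous_map X (top_of_set {0..1}) f" "f x = 0" "f ` C \<subseteq> {1}"
    using cr unfolding completely_regular_space_def by meson
  have f01: "0 \<le> f z" "f z \<le> 1" if "z \<in> topspace X" for z
    using f(1) that by (auto simp: continuous_map_in_subtopology Pi_iff)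
  have fc: "continuous_map X euclideanreal f"
    using f(1) by (simp add: continuous_map_in_subtopology)
  \<comment> \<open>The fibrewise infimum is upper semicontinuous because \<open>q\<close> is open, and lower
    semicontinuous because \<open>q\<close> is closed.\<close>
  define fib where "fib w = {z \<in> topspace X. q z = w}" for w
  define F where "F w = Inf (f ` fib w)" for w
  have ne: "fib w \<noteq> {}" if "w \<in> topspace Y" for w
    using qX[OF that] by (simp add: fib_def)
  have bdd: "bdd_below (f ` fib w)" for w
    using f01(1) by (intro bdd_belowI[of _ 0]) (auto simp: fib_def)
  have F_less: "F w < a \<longleftrightarrow> (\<exists>z \<in> fib w. f z < a)" if "w \<in> topspace Y" for w a
    unfolding F_def using cInf_less_iff[of "f ` fib w" a] ne[OF that] bdd by auto
  have "openin Y {w \<in> topspace Y. F w < a}" for a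
  proof -
    \<comment> \<open>A strict upper bound on an infimum is witnessed by a point of the fibre, so a
      strict sublevel set of \<open>F\<close> is the image of that of \<open>f\<close>.\<close>
    have "{w \<in> topspace Y. F w < a} = q ` {z \<in> topspace X. f z < a}"
      using qY by (auto simp: F_less fib_def)
    moreover have "openin X {z \<in> topspace X. f z < a}"
      using fc unfolding continuous_map_upper_lower_semicontinuous_lte by blast
    ultimately show ?thesis using op by (simp add: open_map_def)
  qed
  moreover have "closedin Y {w \<in> topspace Y. F w \<le> a}" for a
  proof -
    \<comment> \<open>The infimum over a fibre need not be attained, so the image of the sublevel
      set of \<open>f\<close> at \<open>a\<close> itself may be too small. Intersecting the images
      over all levels \<open>b\<close> above \<open>a\<close> repairs this and keeps the set
      closed.\<close>
    have "{w \<in> topspace Y. F w \<le> a} = (\<Inter>b \<in> {a<..}. q ` {z \<in> topspace X. f z \<le> b})"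
    proof (intro equalityI subsetI)
      fix w assume w: "w \<in> {w \<in> topspace Y. F w \<le> a}"
      have "w \<in> q ` {z \<in> topspace X. f z \<le> b}" if "a < b" for b
      proof -
        have "F w < b" using w that by auto
        then obtain z where "z \<in> fib w" "f z < b" using F_less w by blast
        then show ?thesis by (auto simp: fib_def)
      qed
      then show "w \<in> (\<Inter>b \<in> {a<..}. q ` {z \<in> topspace X. f z \<le> b})" by blast
    next
      fix w assume w: "w \<in> (\<Inter>b \<in> {a<..}. q ` {z \<in> topspace X. f z \<le> b})"
      have lt: "\<exists>z \<in> fib w. f z \<le> b" if "a < b" for b
      proof -
        have "w \<in> q ` {z \<in> topspace X. f z \<le> b}" using w that by blast
        then show ?thesis unfolding fib_def by blast
      qed
      have wY: "w \<in> topspace Y"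
        using lt[of "a + 1"] qY by (auto simp: fib_def)
      have "F w \<le> b" if "a < b" for b
      proof -
        obtain z where "z \<in> fib w" "f z \<le> b" using lt \<open>a < b\<close> by blast
        then show ?thesis
          unfolding F_def using cInf_lower[OF imageI[of z "fib w" f] bdd] by simp
      qed
      then show "w \<in> {w \<in> topspace Y. F w \<le> a}"
        using wY dense_ge[of a "F w"] by simp
    qed
    moreover have "closedin Y (q ` {z \<in> topspace X. f z \<le> b})" for b
      using fc cl unfolding continuous_map_upper_lower_semicontinuous_lte closed_map_def by blast
    \<comment> \<open>An intersection of closed sets is closed in \<open>Y\<close> only for a
      nonempty family, the empty one giving the whole type.\<close>
    moreover have "{a<..} \<noteq> {}" by (rule greaterThan_non_empty)
    ultimately show ?thesis by auto
  qed
  ultimately have "continuous_map Y euclideanreal F"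
    unfolding continuous_map_upper_lower_semicontinuous_lte by blast
  moreover have "F y = 0"
  proof (rule antisym)
    have "x \<in> fib y" using x by (simp add: fib_def)
    then show "F y \<le> 0"
      unfolding F_def using cInf_lower[OF imageI[of x "fib y" f] bdd] f(2) by simp
    show "0 \<le> F y" unfolding F_def
    proof (rule cInf_greatest)
      show "f ` fib y \<noteq> {}" using ne y by simp
      show "0 \<le> r" if "r \<in> f ` fib y" for r using that f01(1) by (auto simp: fib_def)
    qed
  qed
  moreover have "F ` S \<subseteq> {1}"
  proof clarify
    fix w assume w: "w \<in> S"
    then have wY: "w \<in> topspace Y" using S closedin_subset by blast
    have "f z = 1" if "z \<in> fib w" for z
      using f(3) w that by (auto simp: fib_def C_def)
    then have "f ` fib w = {1}"
      using ne[OF wY] by auto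
    then show "F w = 1" by (simp add: F_def)
  qed
  ultimately show "\<exists>f. continuous_map Y euclideanreal f \<and> f y = 0 \<and> f ` S \<subseteq> {1}"
    by blast
qed

text \<open>The Hausdorff property is recovered in a roundabout way: a closed surjection carries
  closed points to closed points, and a regular space with closed points is Hausdorff.\<close>

lemma tychonoff_space_open_closed_map_image:
  assumes "tychonoff_space X" "continuous_map X Y q" "open_map X Y q" "closed_map X Y q"
    and "q ` topspace X = topspace Y"
  shows "tychonoff_space Y"
proof -
  have "completely_regular_space Y"
    using assms completely_regular_space_open_closed_map_image
    unfolding tychonoff_space_def by blast
  moreover have "t1_space Y"
    using assms t1_space_closed_map_image Hausdorff_imp_t1_space
    unfolding tychonoff_space_def by blast
  ultimately show ?thesis
    unfolding tychonoff_space_def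
    using completely_regular_imp_regular_space regular_t1_imp_Hausdorff_space by blast
qed

lemma tychonoff_space_prod_topology:
  assumes "tychonoff_space X" "tychonoff_space Y"
  shows "tychonoff_space (prod_topology X Y)"
  using assms unfolding tychonoff_space_def
  by (simp add: completely_regular_space_prod_topology Hausdorff_space_prod_topology)

lemma compact_Hausdorff_imp_tychonoff_space:
  assumes "compact_space X" "Hausdorff_space X"
  shows "tychonoff_space X"
  using assms unfolding tychonoff_space_def
  by (simp add: compact_Hausdorff_or_regular_imp_normal_space normal_imp_completely_regular_space)

text \<open>Serves to exchange the class map of the twisted product for an orbit map with which it
  is compared only on the underlying space.\<close>

lemma quotient_topology_cong:
  assumes "\<And>x. x \<in> topspace X \<Longrightarrow> q x = r x"
  shows "quotient_topology X q = quotient_topology X r"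
proof -
  have "q ` topspace X = r ` topspace X" using assms by (rule image_cong[OF refl])
  moreover have "{x \<in> topspace X. q x \<in> U} = {x \<in> topspace X. r x \<in> U}" for U
    using assms by auto
  ultimately show ?thesis by (simp add: quotient_topology_def)
qed


section \<open>Continuous actions\<close>

text \<open>A \<open>group_action\<close> is a homomorphism into the group of extensional
  bijections. The inverse of \<open>\<phi> k\<close> is the action of the inverse of
  \<open>k\<close>, and extensionality turns the pointwise multiplication law into an equality of
  functions.\<close>

lemma group_actionI:
  assumes "group K"
    and ext: "\<And>k. k \<in> carrier K \<Longrightarrow> \<phi> k \<in> extensional E"
    and closed: "\<And>k x. k \<in> carrier K \<Longrightarrow> x \<in> E \<Longrightarrow> \<phi> k x \<in> E"
    and one: "\<And>x. x \<in> E \<Longrightarrow> \<phi> \<one>\<^bsub>K\<^esub> x = x"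
    and mult: "\<And>k l x. k \<in> carrier K \<Longrightarrow> l \<in> carrier K \<Longrightarrow> x \<in> E \<Longrightarrow>
      \<phi> (k \<otimes>\<^bsub>K\<^esub> l) x = \<phi> k (\<phi> l x)"
  shows "group_action K E \<phi>"
proof -
  interpret K: group K by fact
  have bij: "\<phi> k \<in> Bij E" if k: "k \<in> carrier K" for k
  proof -
    have "bij_betw (\<phi> k) E E"
    proof (rule bij_betw_byWitness[where f' = "\<phi> (inv\<^bsub>K\<^esub> k)"])
      show "\<forall>x\<in>E. \<phi> (inv\<^bsub>K\<^esub> k) (\<phi> k x) = x" "\<forall>x\<in>E. \<phi> k (\<phi> (inv\<^bsub>K\<^esub> k) x) = x"
        using k by (simp_all add: one flip: mult)
      show "\<phi> k ` E \<subseteq> E" "\<phi> (inv\<^bsub>K\<^esub> k) ` E \<subseteq> E"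
        using closed k by auto
    qed
    then show ?thesis using ext[OF k] by (simp add: Bij_def)
  qed
  have "\<phi> (k \<otimes>\<^bsub>K\<^esub> l) = compose E (\<phi> k) (\<phi> l)" if "k \<in> carrier K" "l \<in> carrier K" for k l
    using that ext[of "k \<otimes>\<^bsub>K\<^esub> l"] mult
    by (intro extensionalityI[of _ E]) (auto simp: compose_def)
  then have "\<phi> \<in> hom K (BijGroup E)"
    using bij by (auto simp: hom_def BijGroup_def)
  then have "group_hom K (BijGroup E) \<phi>"
    by (simp add: group_hom_def group_hom_axioms_def \<open>group K\<close> group_BijGroup)
  then show ?thesis by (rule group_action.intro)
qed

lemma continuous_map_group_mult:
  assumes "topological_group K TK" "continuous_map X TK f" "continuous_map X TK g"
  shows "continuous_map X TK (\<lambda>x. f x \<otimes>\<^bsub>K\<^esub> g x)"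
proof -
  have "continuous_map (prod_topology TK TK) TK (\<lambda>(x, y). x \<otimes>\<^bsub>K\<^esub> y)"
    using assms(1) by (simp add: topological_group_def)
  from continuous_map_compose[OF continuous_map_pairedI[OF assms(2,3)] this]
  show ?thesis by (simp add: o_def)
qed

lemma continuous_map_group_inv:
  assumes "topological_group K TK" "continuous_map X TK f"
  shows "continuous_map X TK (\<lambda>x. inv\<^bsub>K\<^esub> (f x))"
proof -
  have "continuous_map TK TK (\<lambda>x. inv\<^bsub>K\<^esub> x)"
    using assms(1) by (simp add: topological_group_def)
  from continuous_map_compose[OF assms(2) this] show ?thesis by (simp add: o_def)
qed

locale continuous_action = group_action K "topspace Z" \<phi>
  for K :: "('k, 'm) monoid_scheme" (structure) and TK :: "'k topology"
    and Z :: "'z topology" and \<phi> +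
  assumes topological_group: "topological_group K TK"
    and continuous: "continuous_map (prod_topology TK Z) Z (\<lambda>(k, z). \<phi> k z)"
begin

sublocale K: group K
  using topological_group by (simp add: topological_group_def)

lemma topspace_K: "topspace TK = carrier K"
  using topological_group by (simp add: topological_group_def)

lemma act_closed: "k \<in> carrier K \<Longrightarrow> z \<in> topspace Z \<Longrightarrow> \<phi> k z \<in> topspace Z"
  using element_image by blast

lemma act_one: "z \<in> topspace Z \<Longrightarrow> \<phi> \<one> z = z"
  using fun_cong[OF id_eq_one, of z] by simp

lemma orbit_refl_mem: "z \<in> topspace Z \<Longrightarrow> z \<in> orbit K \<phi> z"
  unfolding orbit_def using act_one K.one_closed by force

lemma orbit_act:
  assumes "k \<in> carrier K" "z \<in> topspace Z"
  shows "orbit K \<phi> (\<phi> k z) = orbit K \<phi> z"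
proof (intro equalityI subsetI)
  fix w assume "w \<in> orbit K \<phi> (\<phi> k z)"
  then obtain l where "l \<in> carrier K" "w = \<phi> l (\<phi> k z)" by (auto simp: orbit_def)
  then have "w = \<phi> (l \<otimes> k) z" "l \<otimes> k \<in> carrier K" using assms composition_rule by auto
  then show "w \<in> orbit K \<phi> z" by (auto simp: orbit_def)
next
  fix w assume "w \<in> orbit K \<phi> z"
  then obtain l where l: "l \<in> carrier K" "w = \<phi> l z" by (auto simp: orbit_def)
  have "\<phi> (l \<otimes> inv k) (\<phi> k z) = \<phi> (l \<otimes> inv k \<otimes> k) z"
    using l assms by (intro composition_rule[symmetric]) auto
  also have "l \<otimes> inv k \<otimes> k = l" using l assms by (simp add: K.m_assoc)
  finally have "w = \<phi> (l \<otimes> inv k) (\<phi> k z)" using l by simp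
  then show "w \<in> orbit K \<phi> (\<phi> k z)" using l assms by (auto simp: orbit_def)
qed

lemma orbit_eq_iff:
  assumes "z \<in> topspace Z" "w \<in> topspace Z"
  shows "orbit K \<phi> z = orbit K \<phi> w \<longleftrightarrow> (\<exists>k \<in> carrier K. z = \<phi> k w)"
proof
  assume "orbit K \<phi> z = orbit K \<phi> w"
  then have "z \<in> orbit K \<phi> w" using orbit_refl_mem assms by blast
  then show "\<exists>k \<in> carrier K. z = \<phi> k w" by (auto simp: orbit_def)
qed (use orbit_act assms in auto)

lemma continuous_act:
  assumes "continuous_map X TK f" "continuous_map X Z g"
  shows "continuous_map X Z (\<lambda>x. \<phi> (f x) (g x))"
  using continuous_map_compose[OF continuous_map_pairedI[OF assms] continuous]
  by (simp add: o_def)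

lemma quotient_map_orbit: "quotient_map Z (orbit_space K Z \<phi>) (orbit K \<phi>)"
  unfolding orbit_space_def by (rule quotient_map_quotient_topology)

lemma continuous_map_orbit: "continuous_map Z (orbit_space K Z \<phi>) (orbit K \<phi>)"
  using quotient_map_orbit by (rule quotient_imp_continuous_map)

lemma topspace_orbit_space: "topspace (orbit_space K Z \<phi>) = orbit K \<phi> ` topspace Z"
  by (simp add: orbit_space_def)

text \<open>The right-hand side can be read as a union of preimages under the single maps
  \<open>\<phi> k\<close>, or as the projection of a preimage under the whole action map. The first
  reading makes the orbit map open, the second makes it closed when the group is compact.\<close>

lemma saturation_eq:
  assumes "S \<subseteq> topspace Z"
  shows "{z \<in> topspace Z. orbit K \<phi> z \<in> orbit K \<phi> ` S}
    = {z \<in> topspace Z. \<exists>k \<in> carrier K. \<phi> k z \<in> S}"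
proof (intro equalityI subsetI)
  fix z assume "z \<in> {z \<in> topspace Z. orbit K \<phi> z \<in> orbit K \<phi> ` S}"
  then obtain s where "z \<in> topspace Z" "s \<in> S" "orbit K \<phi> s = orbit K \<phi> z" by auto
  then show "z \<in> {z \<in> topspace Z. \<exists>k \<in> carrier K. \<phi> k z \<in> S}"
    using orbit_eq_iff[of s z] assms by auto
next
  fix z assume "z \<in> {z \<in> topspace Z. \<exists>k \<in> carrier K. \<phi> k z \<in> S}"
  then obtain k where k: "z \<in> topspace Z" "k \<in> carrier K" "\<phi> k z \<in> S" by auto
  then have "orbit K \<phi> z = orbit K \<phi> (\<phi> k z)" using orbit_act by simp
  then show "z \<in> {z \<in> topspace Z. orbit K \<phi> z \<in> orbit K \<phi> ` S}" using k by blast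
qed

text \<open>The saturation of an open set is the union of its preimages under the continuous maps
  \<open>\<phi> k\<close>.\<close>

lemma open_map_orbit: "open_map Z (orbit_space K Z \<phi>) (orbit K \<phi>)"
  unfolding open_map_def
proof (intro allI impI)
  fix W assume W: "openin Z W"
  have "{z \<in> topspace Z. \<exists>k \<in> carrier K. \<phi> k z \<in> W}
      = (\<Union>k \<in> carrier K. {z \<in> topspace Z. \<phi> k z \<in> W})" by auto
  moreover have "openin Z {z \<in> topspace Z. \<phi> k z \<in> W}" if "k \<in> carrier K" for k
  proof -
    have "continuous_map Z Z (\<lambda>z. \<phi> k z)"
      using continuous_act[of Z "\<lambda>_. k" "\<lambda>z. z"] that topspace_K by simp
    then show ?thesis using W by (rule openin_continuous_map_preimage)
  qed
  ultimately have "openin Z {z \<in> topspace Z. orbit K \<phi> z \<in> orbit K \<phi> ` W}"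
    using saturation_eq[OF openin_subset[OF W]] by auto
  then show "openin (orbit_space K Z \<phi>) (orbit K \<phi> ` W)"
    using openin_subset[OF W] by (auto simp: orbit_space_def openin_quotient_topology)
qed

text \<open>The pairs \<open>(k, z)\<close> with \<open>\<phi> k z\<close> in a closed set form a
  closed set, and projecting it along the compact factor \<open>TK\<close> gives a closed set,
  namely the saturation.\<close>

lemma closed_map_orbit:
  assumes "compact_space TK"
  shows "closed_map Z (orbit_space K Z \<phi>) (orbit K \<phi>)"
  unfolding closed_map_def
proof (intro allI impI)
  fix C assume C: "closedin Z C"
  have "closedin (prod_topology TK Z) {p \<in> topspace (prod_topology TK Z). (\<lambda>(k, z). \<phi> k z) p \<in> C}"
    using continuous C by (rule closedin_continuous_map_preimage)
  then have "closedin Z (snd ` {p \<in> topspace (prod_topology TK Z). (\<lambda>(k, z). \<phi> k z) p \<in> C})"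
    using closed_map_snd[OF assms, of Z] by (simp add: closed_map_def)
  also have "snd ` {p \<in> topspace (prod_topology TK Z). (\<lambda>(k, z). \<phi> k z) p \<in> C}
      = {z \<in> topspace Z. \<exists>k \<in> carrier K. \<phi> k z \<in> C}"
    using topspace_K by force
  also have "\<dots> = {z \<in> topspace Z. orbit K \<phi> z \<in> orbit K \<phi> ` C}"
    using saturation_eq[OF closedin_subset[OF C]] by simp
  finally have "closedin Z {z \<in> topspace Z. orbit K \<phi> z \<in> orbit K \<phi> ` C}" .
  moreover have "orbit K \<phi> ` C \<subseteq> topspace (orbit_space K Z \<phi>)"
    unfolding topspace_orbit_space using closedin_subset[OF C] by (rule image_mono)
  ultimately show "closedin (orbit_space K Z \<phi>) (orbit K \<phi> ` C)"
    using quotient_map_orbit unfolding quotient_map_closedin by blast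
qed

lemma tychonoff_orbit_space:
  assumes "compact_space TK" "tychonoff_space Z"
  shows "tychonoff_space (orbit_space K Z \<phi>)"
  using tychonoff_space_open_closed_map_image[OF assms(2) continuous_map_orbit open_map_orbit
      closed_map_orbit[OF assms(1)]] topspace_orbit_space by simp

end

lemma free_continuous_action_imp_continuous_action:
  assumes "topological_group K TK" "free_continuous_action K TK Z \<phi>"
  shows "continuous_action K TK Z \<phi>"
  using assms
  by (simp add: free_continuous_action_def continuous_action_def continuous_action_axioms_def)


section \<open>Local triviality and equivariant maps\<close>

text \<open>A trivialization reduced to its group coordinate, the base coordinate being forced to be
  the orbit map. In this form it pulls back along equivariant maps by mere composition.\<close>

definition equivariant_chart ::
  "('k, 'm) monoid_scheme \<Rightarrow> 'k topology \<Rightarrow> 'z topology \<Rightarrow> ('k \<Rightarrow> 'z \<Rightarrow> 'z) \<Rightarrow> 'z set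
    \<Rightarrow> ('z \<Rightarrow> 'k) \<Rightarrow> bool" where
  "equivariant_chart K TK Z \<phi> N t \<longleftrightarrow>
     openin Z N \<and> continuous_map (subtopology Z N) TK t \<and>
     (\<forall>k \<in> carrier K. \<forall>z \<in> N. \<phi> k z \<in> N \<and> t (\<phi> k z) = k \<otimes>\<^bsub>K\<^esub> t z)"

context continuous_action
begin

text \<open>The second coordinate of a trivialization over \<open>U\<close> is such a map on the
  preimage of \<open>U\<close>, which is invariant because acting does not change the orbit.\<close>

lemma locally_trivial_imp_equivariant_chart:
  assumes "locally_trivial_principal_bundle K TK Z \<phi>" "z \<in> topspace Z"
  obtains N t where "equivariant_chart K TK Z \<phi> N t" "z \<in> N"
proof -
  have "orbit K \<phi> z \<in> topspace (orbit_space K Z \<phi>)"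
    using assms(2) topspace_orbit_space by auto
  then obtain U f where U: "openin (orbit_space K Z \<phi>) U" "orbit K \<phi> z \<in> U"
    and hom: "homeomorphic_map (subtopology Z {z \<in> topspace Z. orbit K \<phi> z \<in> U})
          (prod_topology (subtopology (orbit_space K Z \<phi>) U) TK) f"
    and f: "\<And>z k. z \<in> topspace Z \<Longrightarrow> orbit K \<phi> z \<in> U \<Longrightarrow> k \<in> carrier K \<Longrightarrow>
        snd (f (\<phi> k z)) = k \<otimes> snd (f z)"
    using assms(1) unfolding locally_trivial_principal_bundle_def by meson
  define N where "N = {z \<in> topspace Z. orbit K \<phi> z \<in> U}"
  have "openin Z N"
    unfolding N_def using continuous_map_orbit U(1) by (rule openin_continuous_map_preimage)
  moreover have "continuous_map (subtopology Z N) TK (snd \<circ> f)"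
    unfolding N_def
    by (rule continuous_map_snd_of[OF homeomorphic_imp_continuous_map[OF hom]])
  moreover have "\<forall>k \<in> carrier K. \<forall>z \<in> N. \<phi> k z \<in> N \<and> (snd \<circ> f) (\<phi> k z) = k \<otimes> (snd \<circ> f) z"
    using f orbit_act act_closed by (auto simp: N_def)
  ultimately have "equivariant_chart K TK Z \<phi> N (snd \<circ> f)"
    by (simp add: equivariant_chart_def)
  moreover have "z \<in> N" using U assms(2) by (simp add: N_def)
  ultimately show thesis by (rule that)
qed

text \<open>By equivariance \<open>t\<close> restricts to a bijection from each orbit in
  \<open>N\<close> onto the group, so orbit and \<open>t\<close> together determine a point and take
  all pairs of values. What takes work is the continuity of the inverse, obtained here as
  openness.\<close>

lemma equivariant_chart_imp_trivialization:
  assumes chart: "equivariant_chart K TK Z \<phi> N t"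
  shows "openin (orbit_space K Z \<phi>) (orbit K \<phi> ` N)"
    and "{z \<in> topspace Z. orbit K \<phi> z \<in> orbit K \<phi> ` N} = N"
    and "homeomorphic_map (subtopology Z N)
          (prod_topology (subtopology (orbit_space K Z \<phi>) (orbit K \<phi> ` N)) TK)
          (\<lambda>z. (orbit K \<phi> z, t z))"
proof -
  have N: "openin Z N" and t: "continuous_map (subtopology Z N) TK t"
    and inv: "\<And>k z. k \<in> carrier K \<Longrightarrow> z \<in> N \<Longrightarrow> \<phi> k z \<in> N"
    and eqv: "\<And>k z. k \<in> carrier K \<Longrightarrow> z \<in> N \<Longrightarrow> t (\<phi> k z) = k \<otimes> t z"
    using chart by (auto simp: equivariant_chart_def)
  have NZ: "N \<subseteq> topspace Z" using N by (rule openin_subset)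
  have tN: "topspace (subtopology Z N) = N" using NZ by auto
  have tK: "t z \<in> carrier K" if "z \<in> N" for z
    using t that topspace_K tN by (auto simp: continuous_map_def)
  let ?U = "orbit K \<phi> ` N"
  let ?B = "subtopology (orbit_space K Z \<phi>) ?U"
  show openU: "openin (orbit_space K Z \<phi>) ?U"
    using open_map_orbit N by (simp add: open_map_def)
  \<comment> \<open>Being invariant, \<open>N\<close> is the full preimage of its image, which is
    why the orbit map restricted to \<open>N\<close> is still open.\<close>
  show pre: "{z \<in> topspace Z. orbit K \<phi> z \<in> ?U} = N"
  proof -
    have "{z \<in> topspace Z. orbit K \<phi> z \<in> ?U} \<subseteq> N"
      using NZ orbit_eq_iff inv by blast
    then show ?thesis using NZ by blast
  qed
  let ?f = "\<lambda>z. (orbit K \<phi> z, t z)"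
  \<comment> \<open>The group element \<open>k \<otimes> inv (t z)\<close> moves \<open>z\<close>
    within its orbit to the point where \<open>t\<close> takes the value \<open>k\<close>.\<close>
  let ?m = "\<lambda>p. \<phi> (snd p \<otimes> inv (t (fst p))) (fst p)"
  have topB: "topspace ?B = ?U"
    using NZ topspace_orbit_space by auto
  have contf: "continuous_map (subtopology Z N) (prod_topology ?B TK) ?f"
    using t continuous_map_from_subtopology[OF continuous_map_orbit, of N]
    by (auto intro!: continuous_map_pairedI continuous_map_into_subtopology)
  have openq: "open_map (subtopology Z N) ?B (orbit K \<phi>)"
    using open_map_restriction[OF open_map_orbit pre] .
  have openp: "open_map (prod_topology (subtopology Z N) TK) (prod_topology ?B TK)
      (\<lambda>(z, k). (orbit K \<phi> z, k))"
    using open_map_prod_top[OF openq, of TK TK "\<lambda>k. k"] by (simp add: open_map_def)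
  have fm: "?f (?m (z, k)) = (orbit K \<phi> z, k)" if "z \<in> N" "k \<in> carrier K" for z k
  proof -
    have "k \<otimes> inv (t z) \<otimes> t z = k" using that tK by (simp add: K.m_assoc)
    then show ?thesis using that tK NZ by (auto simp: orbit_act eqv)
  qed
  have contm: "continuous_map (prod_topology (subtopology Z N) TK) (subtopology Z N) ?m"
  proof (rule continuous_map_into_subtopology)
    have f: "continuous_map (prod_topology (subtopology Z N) TK) (subtopology Z N) fst"
      by (rule continuous_map_fst)
    have "continuous_map (prod_topology (subtopology Z N) TK) TK (\<lambda>p. t (fst p))"
      using continuous_map_compose[OF f t] by (simp add: o_def)
    then have "continuous_map (prod_topology (subtopology Z N) TK) TK (\<lambda>p. snd p \<otimes> inv (t (fst p)))"
      by (intro continuous_map_group_mult[OF topological_group]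
          continuous_map_group_inv[OF topological_group] continuous_map_snd)
    moreover have "continuous_map (prod_topology (subtopology Z N) TK) Z fst"
      using f by (simp add: continuous_map_in_subtopology)
    ultimately show "continuous_map (prod_topology (subtopology Z N) TK) Z ?m"
      by (rule continuous_act)
    show "?m \<in> topspace (prod_topology (subtopology Z N) TK) \<rightarrow> N"
      using tN topspace_K inv tK by auto
  qed
  \<comment> \<open>\<open>(z, k) \<mapsto> k t(z)\<inverse>z\<close> is a continuous surjection onto \<open>N\<close> whose composite with the
    trivialization is the open map \<open>(z, k) \<mapsto> (Kz, k)\<close>; so the trivialization is open.\<close>
  have surjm: "?m ` topspace (prod_topology (subtopology Z N) TK) = topspace (subtopology Z N)"
  proof
    show "?m ` topspace (prod_topology (subtopology Z N) TK) \<subseteq> topspace (subtopology Z N)"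
      using tN topspace_K inv tK by auto
    show "topspace (subtopology Z N) \<subseteq> ?m ` topspace (prod_topology (subtopology Z N) TK)"
    proof
      fix z assume "z \<in> topspace (subtopology Z N)"
      then have z: "z \<in> N" using tN by simp
      \<comment> \<open>Asking for the value that \<open>t\<close> already has at \<open>z\<close>
        makes the moving group element trivial.\<close>
      then have "z = ?m (z, t z)" using tK act_one NZ by auto
      moreover have "(z, t z) \<in> topspace (prod_topology (subtopology Z N) TK)"
        using z tN tK topspace_K by simp
      ultimately show "z \<in> ?m ` topspace (prod_topology (subtopology Z N) TK)" by (rule image_eqI)
    qed
  qed
  have "open_map (prod_topology (subtopology Z N) TK) (prod_topology ?B TK) (?f \<circ> ?m)"
    using openp
  proof (rule open_map_eq)
    fix p assume "p \<in> topspace (prod_topology (subtopology Z N) TK)"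
    then obtain z k where "p = (z, k)" "z \<in> N" "k \<in> carrier K" using tN topspace_K by auto
    then show "(\<lambda>(z, k). (orbit K \<phi> z, k)) p = (?f \<circ> ?m) p" using fm by simp
  qed
  then have openf: "open_map (subtopology Z N) (prod_topology ?B TK) ?f"
    using contm surjm by (rule open_map_from_composition_left)
  have surjf: "?f ` topspace (subtopology Z N) = topspace (prod_topology ?B TK)"
  proof
    show "?f ` topspace (subtopology Z N) \<subseteq> topspace (prod_topology ?B TK)"
      using topB tN tK topspace_K by auto
    show "topspace (prod_topology ?B TK) \<subseteq> ?f ` topspace (subtopology Z N)"
    proof
      fix p assume "p \<in> topspace (prod_topology ?B TK)"
      then obtain z k where zk: "p = (orbit K \<phi> z, k)" "z \<in> N" "k \<in> carrier K"
        using topB topspace_K by auto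
      then have "p = ?f (?m (z, k))" using fm by simp
      moreover have "?m (z, k) \<in> topspace (subtopology Z N)" using zk tN inv tK by simp
      ultimately show "p \<in> ?f ` topspace (subtopology Z N)" by (rule image_eqI)
    qed
  qed
  have injf: "inj_on ?f (topspace (subtopology Z N))"
  proof (rule inj_onI)
    fix z w assume "z \<in> topspace (subtopology Z N)" "w \<in> topspace (subtopology Z N)" "?f z = ?f w"
    then have zw: "z \<in> N" "w \<in> N" "orbit K \<phi> z = orbit K \<phi> w" "t z = t w" using tN by auto
    then obtain k where k: "k \<in> carrier K" "z = \<phi> k w" using orbit_eq_iff NZ by blast
    then have "k \<otimes> t w = t w" using eqv zw by metis
    then have "k = \<one>" using k tK[OF zw(2)] by simp
    then show "z = w" using k act_one zw NZ by auto
  qed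
  show "homeomorphic_map (subtopology Z N) (prod_topology ?B TK) ?f"
    using contf openf surjf injf by (rule bijective_open_imp_homeomorphic_map)
qed

text \<open>The image of a chart domain in the orbit space serves as \<open>U\<close>; its preimage
  is the domain again, so the homeomorphism built from the chart has the required source.\<close>

lemma equivariant_charts_imp_locally_trivial:
  assumes "\<And>z. z \<in> topspace Z \<Longrightarrow> \<exists>N t. equivariant_chart K TK Z \<phi> N t \<and> z \<in> N"
  shows "locally_trivial_principal_bundle K TK Z \<phi>"
  unfolding locally_trivial_principal_bundle_def
proof
  fix b assume "b \<in> topspace (orbit_space K Z \<phi>)"
  then obtain z where z: "z \<in> topspace Z" "b = orbit K \<phi> z" using topspace_orbit_space by auto
  then obtain N t where N: "equivariant_chart K TK Z \<phi> N t" "z \<in> N" using assms by blast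
  note triv = equivariant_chart_imp_trivialization[OF N(1)]
  have eqv: "\<forall>z \<in> topspace Z. orbit K \<phi> z \<in> orbit K \<phi> ` N \<longrightarrow>
      fst (orbit K \<phi> z, t z) = orbit K \<phi> z \<and>
      (\<forall>k \<in> carrier K. snd (orbit K \<phi> (\<phi> k z), t (\<phi> k z)) = k \<otimes> snd (orbit K \<phi> z, t z))"
    using N(1) triv(2) unfolding equivariant_chart_def by auto
  show "\<exists>U f. openin (orbit_space K Z \<phi>) U \<and> b \<in> U \<and>
        homeomorphic_map (subtopology Z {z \<in> topspace Z. orbit K \<phi> z \<in> U})
          (prod_topology (subtopology (orbit_space K Z \<phi>) U) TK) f \<and>
        (\<forall>z \<in> topspace Z. orbit K \<phi> z \<in> U \<longrightarrow>
           fst (f z) = orbit K \<phi> z \<and>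
           (\<forall>k \<in> carrier K. snd (f (\<phi> k z)) = k \<otimes> snd (f z)))"
    using triv z(2) N(2) eqv
    by (intro exI[of _ "orbit K \<phi> ` N"] exI[of _ "\<lambda>z. (orbit K \<phi> z, t z)"] conjI)
      (simp_all only: imageI)
qed

end


section \<open>The twisted product\<close>

lemma topological_group_subgroup:
  assumes "topological_group G TG" "subgroup H G"
  shows "topological_group (G\<lparr>carrier := H\<rparr>) (subtopology TG H)"
proof -
  interpret G: group G using assms by (simp add: topological_group_def)
  interpret H: subgroup H G by fact
  have HG: "H \<subseteq> topspace TG" using assms(1) H.subset by (simp add: topological_group_def)
  have tH: "topspace (subtopology TG H) = H" using HG by auto
  have id: "continuous_map (subtopology TG H) TG (\<lambda>x. x)"
    by (simp add: continuous_map_from_subtopology)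
  have "continuous_map (prod_topology (subtopology TG H) (subtopology TG H)) TG
      (\<lambda>p. fst p \<otimes>\<^bsub>G\<^esub> snd p)"
    using continuous_map_fst[of "subtopology TG H" "subtopology TG H"]
      continuous_map_snd[of "subtopology TG H" "subtopology TG H"]
    by (intro continuous_map_group_mult[OF assms(1)]) (auto simp: continuous_map_in_subtopology)
  then have "continuous_map (prod_topology (subtopology TG H) (subtopology TG H)) (subtopology TG H)
      (\<lambda>p. fst p \<otimes>\<^bsub>G\<^esub> snd p)"
    by (rule continuous_map_into_subtopology) auto
  moreover have "continuous_map (subtopology TG H) (subtopology TG H) (\<lambda>x. inv\<^bsub>G\<^esub> x)"
    using continuous_map_group_inv[OF assms(1) id]
    by (rule continuous_map_into_subtopology) auto
  \<comment> \<open>The inverse of the group with carrier \<open>H\<close> is a different function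
    from that of \<open>G\<close>; the two agree on \<open>H\<close>.\<close>
  then have "continuous_map (subtopology TG H) (subtopology TG H)
      (\<lambda>x. inv\<^bsub>G\<lparr>carrier := H\<rparr>\<^esub> x)"
    by (rule continuous_map_eq) (simp add: G.m_inv_consistent[OF assms(2)])
  ultimately show ?thesis
    unfolding topological_group_def tH
    using G.subgroup_imp_group[OF assms(2)] by (simp add: case_prod_unfold)
qed

locale twisted_action_setup =
  fixes G :: "('g, 'm) monoid_scheme" (structure) and TG :: "'g topology" and H :: "'g set"
    and Y :: "'y topology" and \<phi> :: "'g \<Rightarrow> 'y \<Rightarrow> 'y"
  assumes topological_group: "topological_group G TG"
    and subgroup: "subgroup H G"
    and free: "free_continuous_action (G\<lparr>carrier := H\<rparr>) (subtopology TG H) Y \<phi>"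
begin

abbreviation "cls p \<equiv> twisted_rel G H (topspace Y) \<phi> `` {p}"
abbreviation "X \<equiv> twisted_product G TG H Y \<phi>"
abbreviation "act \<equiv> twisted_action G TG H Y \<phi>"

sublocale G: group G
  using topological_group by (simp add: topological_group_def)

sublocale H: subgroup H G
  by (rule subgroup)

sublocale A: continuous_action "G\<lparr>carrier := H\<rparr>" "subtopology TG H" Y \<phi>
  using free_continuous_action_imp_continuous_action topological_group_subgroup
    topological_group subgroup free by blast

lemma topspace_G: "topspace TG = carrier G"
  using topological_group by (simp add: topological_group_def)

lemma phi_closed: "h \<in> H \<Longrightarrow> y \<in> topspace Y \<Longrightarrow> \<phi> h y \<in> topspace Y"
  using A.act_closed by simp

lemma phi_mult: "h \<in> H \<Longrightarrow> k \<in> H \<Longrightarrow> y \<in> topspace Y \<Longrightarrow> \<phi> (h \<otimes> k) y = \<phi> h (\<phi> k y)"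
  using A.composition_rule by simp

lemma phi_one: "y \<in> topspace Y \<Longrightarrow> \<phi> \<one> y = y"
  using A.act_one by simp

text \<open>The relation is an equivalence as it stands, so equal classes are linked by a single
  \<open>h\<close>. Both the freeness of the twisted action and the equivariance of the map from
  \<open>Y\<close> to the twisted product are read off from this.\<close>

lemma cls_eq_iff:
  assumes "a \<in> carrier G" "b \<in> carrier G" "y \<in> topspace Y" "z \<in> topspace Y"
  shows "cls (a, y) = cls (b, z) \<longleftrightarrow> (\<exists>h \<in> H. a = b \<otimes> h \<and> z = \<phi> h y)"
proof -
  have "equiv (carrier G \<times> topspace Y) (twisted_rel G H (topspace Y) \<phi>)"
    using equiv_twisted_rel G.group_axioms subgroup A.group_action_axioms by blast
  then have "cls (a, y) = cls (b, z) \<longleftrightarrow> ((a, y), (b, z)) \<in> twisted_rel G H (topspace Y) \<phi>"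
    using assms by (intro eq_equiv_class_iff) auto
  then show ?thesis using assms by (auto simp: twisted_rel_def)
qed

lemma topspace_X: "topspace X = cls ` (carrier G \<times> topspace Y)"
  by (simp add: twisted_product_def topspace_G)

lemma act_cls:
  assumes "g \<in> carrier G" "a \<in> carrier G" "y \<in> topspace Y"
  shows "act g (cls (a, y)) = cls (g \<otimes> a, y)"
  using twisted_action_class[OF G.group_axioms subgroup A.group_action_axioms topspace_G assms] .

lemma X_cases:
  assumes "x \<in> topspace X"
  obtains a y where "a \<in> carrier G" "y \<in> topspace Y" "x = cls (a, y)"
  using assms unfolding topspace_X by blast

lemma cls_in_X: "a \<in> carrier G \<Longrightarrow> y \<in> topspace Y \<Longrightarrow> cls (a, y) \<in> topspace X"
  unfolding topspace_X by blast

lemma continuous_map_cls: "continuous_map (prod_topology TG Y) X cls"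
  unfolding twisted_product_def by (rule quotient_imp_continuous_map[OF quotient_map_quotient_topology])

section \<open>The twisted product as an orbit space\<close>

text \<open>The inverse in the first coordinate turns right multiplication into a left action.
  Acting by \<open>h\<close> on \<open>(g \<otimes> h, y)\<close> gives
  \<open>(g, \<phi> h y)\<close>, the identification that defines the twisted product. The
  restriction provides extensionality.\<close>

definition diagonal_action :: "'g \<Rightarrow> 'g \<times> 'y \<Rightarrow> 'g \<times> 'y" where
  "diagonal_action h = (\<lambda>p \<in> carrier G \<times> topspace Y. (fst p \<otimes> inv h, \<phi> h (snd p)))"

sublocale D: continuous_action "G\<lparr>carrier := H\<rparr>" "subtopology TG H" "prod_topology TG Y" diagonal_action
proof -
  have ga: "group_action (G\<lparr>carrier := H\<rparr>) (topspace (prod_topology TG Y)) diagonal_action"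
  proof (rule group_actionI)
    show "group (G\<lparr>carrier := H\<rparr>)" by (rule G.subgroup_imp_group[OF subgroup])
  qed (auto simp: diagonal_action_def topspace_G phi_closed phi_one phi_mult G.inv_mult_group G.m_assoc)
  let ?P = "prod_topology (subtopology TG H) (prod_topology TG Y)"
  have H: "continuous_map ?P (subtopology TG H) fst" by (rule continuous_map_fst)
  have HG: "continuous_map ?P TG fst" using H by (simp add: continuous_map_in_subtopology)
  have s: "continuous_map ?P (prod_topology TG Y) snd" by (rule continuous_map_snd)
  have G: "continuous_map ?P TG (\<lambda>p. fst (snd p))" and Y: "continuous_map ?P Y (\<lambda>p. snd (snd p))"
    using continuous_map_fst_of[OF s] continuous_map_snd_of[OF s] by (simp_all add: o_def)
  have "continuous_map ?P (prod_topology TG Y)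
      (\<lambda>p. (fst (snd p) \<otimes> inv (fst p), \<phi> (fst p) (snd (snd p))))"
    by (intro continuous_map_pairedI continuous_map_group_mult[OF topological_group G]
        continuous_map_group_inv[OF topological_group HG] A.continuous_act[OF H Y])
  then have "continuous_map ?P (prod_topology TG Y) (\<lambda>(h, p). diagonal_action h p)"
    by (rule continuous_map_eq) (auto simp: diagonal_action_def topspace_G)
  with ga show "continuous_action (G\<lparr>carrier := H\<rparr>) (subtopology TG H) (prod_topology TG Y) diagonal_action"
    by (intro continuous_action.intro continuous_action_axioms.intro
        topological_group_subgroup topological_group subgroup)
qed

text \<open>Solving \<open>a = b \<otimes> h\<close> for \<open>b\<close> rewrites a member
  \<open>(b, \<phi> h y)\<close> of the class of \<open>(a, y)\<close> as the translate of
  \<open>(a, y)\<close> by \<open>h\<close>.\<close>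

lemma cls_eq_orbit:
  assumes "p \<in> topspace (prod_topology TG Y)"
  shows "cls p = orbit (G\<lparr>carrier := H\<rparr>) diagonal_action p"
proof -
  obtain a y where p: "p = (a, y)" "a \<in> carrier G" "y \<in> topspace Y"
    using assms by (auto simp: topspace_G)
  have "r \<in> cls p \<longleftrightarrow> r \<in> orbit (G\<lparr>carrier := H\<rparr>) diagonal_action p" for r
  proof
    assume "r \<in> cls p"
    then obtain b h where bh: "b \<in> carrier G" "h \<in> H" "a = b \<otimes> h" "r = (b, \<phi> h y)"
      using p unfolding twisted_rel_def by auto
    then have "b = a \<otimes> inv h" by (simp add: G.m_assoc)
    then have "r = diagonal_action h p" using bh p by (simp add: diagonal_action_def)
    then show "r \<in> orbit (G\<lparr>carrier := H\<rparr>) diagonal_action p"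
      using bh by (auto simp: orbit_def)
  next
    assume "r \<in> orbit (G\<lparr>carrier := H\<rparr>) diagonal_action p"
    then obtain h where h: "h \<in> H" "r = diagonal_action h p" by (auto simp: orbit_def)
    then have "r = (a \<otimes> inv h, \<phi> h y)" using p by (simp add: diagonal_action_def)
    moreover have "a = a \<otimes> inv h \<otimes> h" "a \<otimes> inv h \<in> carrier G"
      using p h by (auto simp: G.m_assoc)
    ultimately show "r \<in> cls p" using p h unfolding twisted_rel_def by blast
  qed
  then show ?thesis by blast
qed

text \<open>Gives access to the facts about orbit maps: the class map is open, and for compact
  \<open>H\<close> the Tychonoff property passes to the quotient.\<close>

lemma twisted_product_eq_orbit_space:
  "X = orbit_space (G\<lparr>carrier := H\<rparr>) (prod_topology TG Y) diagonal_action"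
  unfolding twisted_product_def orbit_space_def
  by (rule quotient_topology_cong) (rule cls_eq_orbit)

lemma open_map_cls: "open_map (prod_topology TG Y) X cls"
  unfolding twisted_product_eq_orbit_space
  using D.open_map_orbit by (rule open_map_eq) (simp add: cls_eq_orbit)

lemma tychonoff_twisted_product:
  assumes "tychonoff_space TG" "tychonoff_space Y" "compact_space (subtopology TG H)"
  shows "tychonoff_space X"
  unfolding twisted_product_eq_orbit_space
  using D.tychonoff_orbit_space[OF assms(3) tychonoff_space_prod_topology[OF assms(1,2)]] .

lemma compact_twisted_product:
  assumes "compact_space TG" "compact_space Y"
  shows "compact_space X"
proof -
  have "compact_space (prod_topology TG Y)"
    using assms by (simp add: compact_space_prod_topology)
  then have "compactin X (cls ` topspace (prod_topology TG Y))"
    unfolding compact_space_def using continuous_map_cls by (rule image_compactin)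
  then show ?thesis
    by (simp add: compact_space_def topspace_X topspace_G)
qed

section \<open>Continuity and freeness of the induced action\<close>

lemma free_continuous_twisted_action: "free_continuous_action G TG X act"
  unfolding free_continuous_action_def
proof (intro conjI ballI)
  show "group_action G (topspace X) act"
  proof (rule group_actionI)
    show "group G" by (rule G.group_axioms)
    show "act g \<in> extensional (topspace X)" for g
      unfolding twisted_action_def by simp
    show "act g x \<in> topspace X" if "g \<in> carrier G" "x \<in> topspace X" for g x
      using that by (elim X_cases) (simp only: act_cls cls_in_X G.m_closed)
    show "act \<one> x = x" if "x \<in> topspace X" for x
      using that by (elim X_cases) (simp only: act_cls G.one_closed G.l_one)
    show "act (g \<otimes> g') x = act g (act g' x)"
      if "g \<in> carrier G" "g' \<in> carrier G" "x \<in> topspace X" for g g' x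
      using that by (elim X_cases) (simp only: act_cls G.m_closed G.m_assoc)
  qed
next
  \<comment> \<open>Continuity of the action is tested after pulling back along \<open>?q\<close>.
    That \<open>?q\<close> is a quotient map rests on the openness of the class map.\<close>
  let ?q = "\<lambda>(g, p). (g, cls p)" and ?P = "prod_topology TG (prod_topology TG Y)"
  have "continuous_map ?P (prod_topology TG X) ?q"
    using continuous_map_cls continuous_map_prod_top[of TG "prod_topology TG Y" TG X "\<lambda>g. g" cls]
    by simp
  moreover have "open_map ?P (prod_topology TG X) ?q"
    using open_map_prod_top[of TG TG "\<lambda>g. g", OF _ open_map_cls] by (simp add: open_map_def)
  moreover have "?q ` topspace ?P = topspace (prod_topology TG X)"
    unfolding topspace_prod_topology topspace_X topspace_G by force
  ultimately have quot: "quotient_map ?P (prod_topology TG X) ?q"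
    by (rule continuous_open_imp_quotient_map)
  have s: "continuous_map ?P (prod_topology TG Y) snd" by (rule continuous_map_snd)
  have G: "continuous_map ?P TG (\<lambda>p. fst (snd p))" and Y: "continuous_map ?P Y (\<lambda>p. snd (snd p))"
    using continuous_map_fst_of[OF s] continuous_map_snd_of[OF s] by (simp_all add: o_def)
  have "continuous_map ?P (prod_topology TG Y) (\<lambda>p. (fst p \<otimes> fst (snd p), snd (snd p)))"
    by (intro continuous_map_pairedI continuous_map_group_mult[OF topological_group _ G] Y
        continuous_map_fst)
  from continuous_map_compose[OF this continuous_map_cls]
  have "continuous_map ?P X ((\<lambda>(g, x). act g x) \<circ> ?q)"
    by (rule continuous_map_eq) (auto simp: topspace_G act_cls)
  with quot show "continuous_map (prod_topology TG X) X (\<lambda>(g, x). act g x)"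
    by (rule continuous_compose_quotient_map)
next
  fix x assume "x \<in> topspace X"
  then obtain a y where ay: "a \<in> carrier G" "y \<in> topspace Y" "x = cls (a, y)" by (rule X_cases)
  have "g = \<one>" if g: "g \<in> carrier G" "act g x = x" for g
  proof -
    \<comment> \<open>An element \<open>g\<close> fixing the class is conjugate by \<open>a\<close>
      to an element of \<open>H\<close> fixing \<open>y\<close>, which is trivial by freeness on
      \<open>Y\<close>.\<close>
    have "cls (g \<otimes> a, y) = cls (a, y)" using g ay act_cls by simp
    then obtain h where h: "h \<in> H" "g \<otimes> a = a \<otimes> h" "\<phi> h y = y"
      using cls_eq_iff[of "g \<otimes> a" a y y] g ay by auto
    then have "h \<in> stabilizer (G\<lparr>carrier := H\<rparr>) \<phi> y" by (simp add: stabilizer_def)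
    then have "h = \<one>" using free ay by (auto simp: free_continuous_action_def)
    then show ?thesis using h g ay by simp
  qed
  moreover have "act \<one> x = x" using ay act_cls by simp
  ultimately show "stabilizer G act x = {\<one>}" by (auto simp: stabilizer_def)
qed

section \<open>Descent of local triviality to \<open>Y\<close>\<close>

text \<open>Charts are pulled back twice along \<open>H\<close>-equivariant maps. The first map goes
  from \<open>Y\<close> to \<open>X\<close>, and a chart of \<open>X\<close> continues it into
  \<open>G\<close>; a chart of \<open>G\<close> for translation by \<open>H\<close> then leads into
  \<open>H\<close>. The domain shrinks at each stage and stays open and invariant.\<close>

lemma principal_base_action:
  assumes GH: "principal_action (G\<lparr>carrier := H\<rparr>) (subtopology TG H) TG (translation_action G)"
    and X: "principal_action G TG X act"
  shows "principal_action (G\<lparr>carrier := H\<rparr>) (subtopology TG H) Y \<phi>"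
proof -
  interpret T: continuous_action "G\<lparr>carrier := H\<rparr>" "subtopology TG H" TG "translation_action G"
    using GH free_continuous_action_imp_continuous_action
      topological_group_subgroup[OF topological_group subgroup]
    unfolding principal_action_def by blast
  interpret B: continuous_action G TG X act
    using X free_continuous_action_imp_continuous_action topological_group
    unfolding principal_action_def by blast
  let ?j = "\<lambda>y. cls (\<one>, y)"
  have jcont: "continuous_map Y X ?j"
  proof -
    have "continuous_map Y (prod_topology TG Y) (\<lambda>y. (\<one>, y))"
      by (intro continuous_map_pairedI) (simp_all add: topspace_G)
    from continuous_map_compose[OF this continuous_map_cls] show ?thesis by (simp add: o_def)
  qed
  \<comment> \<open>Both sides are the class of \<open>(h, y)\<close>: on one side \<open>h\<close>
    crosses from the first coordinate to the second, on the other it multiplies the unit.\<close>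
  have jeq: "?j (\<phi> h y) = act h (?j y)" if "h \<in> H" "y \<in> topspace Y" for h y
  proof -
    have "cls (h, y) = cls (\<one>, \<phi> h y)"
      using that phi_closed cls_eq_iff[of h \<one> y "\<phi> h y"] by auto
    then show ?thesis using that act_cls by simp
  qed
  have "\<exists>N t. equivariant_chart (G\<lparr>carrier := H\<rparr>) (subtopology TG H) Y \<phi> N t \<and> y \<in> N"
    if y: "y \<in> topspace Y" for y
  proof -
    have "?j y \<in> topspace X" using y cls_in_X by simp
    then obtain W r where W: "equivariant_chart G TG X act W r" "?j y \<in> W"
      using B.locally_trivial_imp_equivariant_chart X unfolding principal_action_def by blast
    define N0 where "N0 = {y \<in> topspace Y. ?j y \<in> W}"
    define r0 where "r0 = (\<lambda>y. r (?j y))"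
    have N0: "openin Y N0"
      unfolding N0_def using jcont W(1)
      by (auto simp: equivariant_chart_def intro: openin_continuous_map_preimage)
    have tN0: "topspace (subtopology Y N0) = N0" by (auto simp: N0_def)
    have "continuous_map (subtopology Y N0) (subtopology X W) ?j"
      using continuous_map_from_subtopology[OF jcont]
      by (rule continuous_map_into_subtopology) (auto simp: N0_def)
    then have r0: "continuous_map (subtopology Y N0) TG r0"
      using W(1) continuous_map_compose unfolding equivariant_chart_def r0_def o_def by blast
    have r0G: "r0 x \<in> carrier G" if "x \<in> N0" for x
      using r0 that tN0 topspace_G by (auto simp: continuous_map_def)
    \<comment> \<open>The chart \<open>r\<close> is equivariant under all of \<open>G\<close>; the
      elements of \<open>H\<close> are the ones that \<open>?j\<close> relates to the action on
      \<open>Y\<close>.\<close>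
    have N0inv: "\<phi> h x \<in> N0" and r0eq: "r0 (\<phi> h x) = h \<otimes> r0 x" if "h \<in> H" "x \<in> N0" for h x
      using that W(1) jeq phi_closed by (auto simp: equivariant_chart_def N0_def r0_def)
    have yN0: "y \<in> N0" using y W by (simp add: N0_def)
    then have "r0 y \<in> topspace TG" using r0G topspace_G by simp
    then obtain V s where
      V: "equivariant_chart (G\<lparr>carrier := H\<rparr>) (subtopology TG H) TG (translation_action G) V s"
        "r0 y \<in> V"
      using T.locally_trivial_imp_equivariant_chart GH unfolding principal_action_def by blast
    \<comment> \<open>Since \<open>translation_action\<close> is extensional, it is plain
      multiplication only on the carrier, so \<open>V\<close> has to be seen to lie there.\<close>
    have seq: "h \<otimes> g \<in> V" "s (h \<otimes> g) = h \<otimes> s g" if "h \<in> H" "g \<in> V" for h g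
    proof -
      have "g \<in> carrier G"
        using V(1) that openin_subset topspace_G unfolding equivariant_chart_def by blast
      then have "translation_action G h g = h \<otimes> g" by (simp add: translation_action_def)
      then show "h \<otimes> g \<in> V" "s (h \<otimes> g) = h \<otimes> s g"
        using V(1) that unfolding equivariant_chart_def by force+
    qed
    define N where "N = {x \<in> N0. r0 x \<in> V}"
    \<comment> \<open>The map \<open>r0\<close> is known to be continuous only on \<open>N0\<close>,
      so openness is first obtained in that subspace and then transferred to
      \<open>Y\<close>.\<close>
    have "openin (subtopology Y N0) {x \<in> topspace (subtopology Y N0). r0 x \<in> V}"
      using r0 V(1) unfolding equivariant_chart_def by (blast intro: openin_continuous_map_preimage)
    then have N: "openin Y N"
      unfolding tN0 N_def[symmetric] using openin_trans_full[OF _ N0] by blast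
    have "continuous_map (subtopology Y N) (subtopology TG V) r0"
    proof (rule continuous_map_into_subtopology)
      show "continuous_map (subtopology Y N) TG r0"
        using continuous_map_from_subtopology_mono[OF r0] by (auto simp: N_def)
    qed (auto simp: N_def)
    then have "continuous_map (subtopology Y N) (subtopology TG H) (\<lambda>x. s (r0 x))"
      using V(1) continuous_map_compose unfolding equivariant_chart_def o_def by blast
    moreover have "\<phi> h x \<in> N \<and> s (r0 (\<phi> h x)) = h \<otimes> s (r0 x)" if "h \<in> H" "x \<in> N" for h x
      using that N0inv r0eq seq by (auto simp: N_def)
    ultimately have "equivariant_chart (G\<lparr>carrier := H\<rparr>) (subtopology TG H) Y \<phi> N (\<lambda>x. s (r0 x))"
      using N by (simp add: equivariant_chart_def)
    moreover have "y \<in> N" using yN0 V(2) by (simp add: N_def)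
    ultimately show ?thesis by blast
  qed
  then show ?thesis
    unfolding principal_action_def using free A.equivariant_charts_imp_locally_trivial by blast
qed

end

text \<open>Points of the twisted product are sets of pairs. The hypotheses on all actions of
  \<open>G\<close> therefore range over topologies on the type \<open>('g \<times> 'y) set\<close>,
  where they are applied to the twisted product.\<close>

theorem lemma1p5:
  fixes G :: "('g, 'm) monoid_scheme" and TG :: "'g topology" and H :: "'g set"
  assumes "topological_group G TG" and "tychonoff_space TG"
    and "subgroup H G" and "closedin TG H"
    and "principal_action (G\<lparr>carrier := H\<rparr>) (subtopology TG H) TG (translation_action G)"
  shows
    "(\<forall>(Y :: 'y topology) \<phi>.
        tychonoff_space Y \<longrightarrow>
        free_continuous_action (G\<lparr>carrier := H\<rparr>) (subtopology TG H) Y \<phi> \<longrightarrow>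
        principal_action G TG (twisted_product G TG H Y \<phi>) (twisted_action G TG H Y \<phi>) \<longrightarrow>
        principal_action (G\<lparr>carrier := H\<rparr>) (subtopology TG H) Y \<phi>)
     \<and>
     (compact_space TG \<longrightarrow>
       ((\<forall>(X :: ('g \<times> 'y) set topology) \<psi>.
           tychonoff_space X \<longrightarrow> free_continuous_action G TG X \<psi> \<longrightarrow>
           principal_action G TG X \<psi>) \<longrightarrow>
        (\<forall>(Y :: 'y topology) \<phi>.
           tychonoff_space Y \<longrightarrow>
           free_continuous_action (G\<lparr>carrier := H\<rparr>) (subtopology TG H) Y \<phi> \<longrightarrow>
           principal_action (G\<lparr>carrier := H\<rparr>) (subtopology TG H) Y \<phi>))
       \<and>
       ((\<forall>(X :: ('g \<times> 'y) set topology) \<psi>.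
           compact_space X \<longrightarrow> Hausdorff_space X \<longrightarrow> free_continuous_action G TG X \<psi> \<longrightarrow>
           principal_action G TG X \<psi>) \<longrightarrow>
        (\<forall>(Y :: 'y topology) \<phi>.
           compact_space Y \<longrightarrow> Hausdorff_space Y \<longrightarrow>
           free_continuous_action (G\<lparr>carrier := H\<rparr>) (subtopology TG H) Y \<phi> \<longrightarrow>
           principal_action (G\<lparr>carrier := H\<rparr>) (subtopology TG H) Y \<phi>)))"
proof -
  have twisted: "twisted_action_setup G TG H Y \<phi>"
    if "free_continuous_action (G\<lparr>carrier := H\<rparr>) (subtopology TG H) Y \<phi>"
    for Y :: "'y topology" and \<phi>
    using assms(1,3) that by (rule twisted_action_setup.intro)
  note base = twisted_action_setup.principal_base_action[OF twisted assms(5)]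
  \<comment> \<open>Closedness of the embedding passes compactness from \<open>G\<close> to
    \<open>H\<close>, the group whose orbits form the twisted product.\<close>
  have H: "compact_space (subtopology TG H)" if "compact_space TG"
    using closedin_compact_space[OF that assms(4)] by (rule compact_space_subtopology)
  note tych = twisted_action_setup.tychonoff_twisted_product[OF twisted assms(2) _ H]
  show ?thesis
  proof (intro conjI impI allI)
    fix Y :: "'y topology" and \<phi>
    assume "free_continuous_action (G\<lparr>carrier := H\<rparr>) (subtopology TG H) Y \<phi>"
      and "principal_action G TG (twisted_product G TG H Y \<phi>) (twisted_action G TG H Y \<phi>)"
    then show "principal_action (G\<lparr>carrier := H\<rparr>) (subtopology TG H) Y \<phi>"
      by (rule base)
  next
    fix Y :: "'y topology" and \<phi>
    assume c: "compact_space TG" and Y: "tychonoff_space Y"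
      and free: "free_continuous_action (G\<lparr>carrier := H\<rparr>) (subtopology TG H) Y \<phi>"
      and all: "\<forall>(X :: ('g \<times> 'y) set topology) \<psi>. tychonoff_space X \<longrightarrow>
        free_continuous_action G TG X \<psi> \<longrightarrow> principal_action G TG X \<psi>"
    have "principal_action G TG (twisted_product G TG H Y \<phi>) (twisted_action G TG H Y \<phi>)"
      using all tych[OF free Y c]
        twisted_action_setup.free_continuous_twisted_action[OF twisted[OF free]] by blast
    then show "principal_action (G\<lparr>carrier := H\<rparr>) (subtopology TG H) Y \<phi>"
      by (rule base[OF free])
  next
    fix Y :: "'y topology" and \<phi>
    assume c: "compact_space TG" and Y: "compact_space Y" "Hausdorff_space Y"
      and free: "free_continuous_action (G\<lparr>carrier := H\<rparr>) (subtopology TG H) Y \<phi>"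
      and all: "\<forall>(X :: ('g \<times> 'y) set topology) \<psi>. compact_space X \<longrightarrow> Hausdorff_space X \<longrightarrow>
        free_continuous_action G TG X \<psi> \<longrightarrow> principal_action G TG X \<psi>"
    \<comment> \<open>The Hausdorff half comes from the Tychonoff case, compact Hausdorff spaces
      being Tychonoff; compactness comes from \<open>G \<times> Y\<close> by the class map.\<close>
    have "Hausdorff_space (twisted_product G TG H Y \<phi>)"
      using tych[OF free compact_Hausdorff_imp_tychonoff_space[OF Y] c]
      by (simp add: tychonoff_space_def)
    then have "principal_action G TG (twisted_product G TG H Y \<phi>) (twisted_action G TG H Y \<phi>)"
      using all twisted_action_setup.compact_twisted_product[OF twisted[OF free] c Y(1)]
        twisted_action_setup.free_continuous_twisted_action[OF twisted[OF free]] by blast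
    then show "principal_action (G\<lparr>carrier := H\<rparr>) (subtopology TG H) Y \<phi>"
      by (rule base[OF free])
  qed
qed

end
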